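(* Let $X=D\cup S$ be a finite set of defeasible sentences ($D$) and strict sentences ($S$) built from formulas of $\mathcal{F}$. Consider the following two-phase procedure. Phase 1: set $D':=D$; while $D'\neq\emptyset$, find a sentence $d\in D'$ that is tolerated by $S\cup D'$; if one is found, replace $D'$ by $D'\setminus\{d\}$, otherwise halt and report INCONSISTENT. Phase 2: test for each $s\in S$ whether $s$ is tolerated by $S$ (without removing any sentence from $S$); if some $s\in S$ is not tolerated by $S$, halt and report INCONSISTENT. If both phases complete, report CONSISTENT. Then, whatever choices of tolerated sentences are made in Phase 1, the procedure reports CONSISTENT if $X$ is p-consistent and reports INCONSISTENT if $X$ is not p-consistent.
   Context: $\mathcal{F}$ is the set of propositional formulas over a fixed finite set of propositional variables. A defeasible sentence is an expression $\phi \rightarrow \psi$ and a strict sentence is an expression $\phi \Rightarrow \psi$, with $\phi,\psi \in \mathcal{F}$ (the two kinds are formally distinct). A conditional sentence is a sentence of either kind, with antecedent $\phi$ and consequent $\psi$. Truth assignments: a truth assignment $t$ maps formulas to $\{0,1\}$ respecting the boolean connectives. A conditional sentence with antecedent $\phi$ and consequent $\psi$ is verified by $t$ if $t(\phi)=t(\psi)=1$ and falsified by $t$ if $t(\phi)=1$ and $t(\psi)=0$. A conditional sentence $x$ is tolerated by a set $Y$ of conditional sentences if some truth assignment verifies $x$ and falsifies no sentence of $Y$. Probability assignments: let $P$ be a probability distribution on the (finite) set of truth assignments. For a conditional sentence $x$ (defeasible or strict) with antecedent $\phi$ and consequent $\psi$, $$P(x) = \frac{\sum_t P(t)\, t(\phi\wedge\psi)}{\sum_t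 P(t)\, t(\phi)}.$$ $P$ is proper for a set of sentences if this denominator is non-zero for each sentence of the set. $X = D\cup S$ is p-consistent if for every $\varepsilon>0$ there is a $P$ proper for $X$ with $P(d)\ge 1-\varepsilon$ for all $d\in D$ and $P(s)=1$ for all $s\in S$. *)

theory Defs
  imports "HOL-Probability.Probability_Mass_Function"
begin

datatype 'v form =
    Atom 'v
  | Bot
  | Neg "'v form"
  | Conj "'v form" "'v form"
  | Disj "'v form" "'v form"
  | Impl "'v form" "'v form"

datatype 'v sentence =
    is_defeasible: Defeasible (antecedent: "'v form") (consequent: "'v form")
  | is_strict: Strict (antecedent: "'v form") (consequent: "'v form")


text \<open>Truth values 0 and 1 are represented by \<^const>\<open>False\<close> and \<^const>\<open>True\<close>.\<close>

definition truth_assignment :: "('v form \<Rightarrow> bool) \<Rightarrow> bool" where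
  "truth_assignment t \<longleftrightarrow>
     \<not> t Bot \<and>
     (\<forall>\<phi>. t (Neg \<phi>) \<longleftrightarrow> \<not> t \<phi>) \<and>
     (\<forall>\<phi> \<psi>. t (Conj \<phi> \<psi>) \<longleftrightarrow> t \<phi> \<and> t \<psi>) \<and>
     (\<forall>\<phi> \<psi>. t (Disj \<phi> \<psi>) \<longleftrightarrow> t \<phi> \<or> t \<psi>) \<and>
     (\<forall>\<phi> \<psi>. t (Impl \<phi> \<psi>) \<longleftrightarrow> (t \<phi> \<longrightarrow> t \<psi>))"

text \<open>The sums over truth assignments below range over a finite set, so they are not
  the default value 0.\<close>

lemma finite_truth_assignments: "finite {t :: ('v::finite) form \<Rightarrow> bool. truth_assignment t}"
proof (rule inj_on_finite[where f = "\<lambda>t v. t (Atom v)" and B = UNIV])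
  show "inj_on (\<lambda>t v. t (Atom v)) {t :: 'v form \<Rightarrow> bool. truth_assignment t}"
  proof (rule inj_onI)
    fix t u :: "'v form \<Rightarrow> bool"
    assume "t \<in> {t. truth_assignment t}" "u \<in> {t. truth_assignment t}"
      and eq: "(\<lambda>v. t (Atom v)) = (\<lambda>v. u (Atom v))"
    then have "truth_assignment t" "truth_assignment u" by auto
    then have "t \<phi> = u \<phi>" for \<phi>
      by (induction \<phi>) (use eq in \<open>auto simp: truth_assignment_def dest: fun_cong\<close>)
    then show "t = u" by blast
  qed
qed auto

definition verifies :: "('v form \<Rightarrow> bool) \<Rightarrow> 'v sentence \<Rightarrow> bool" where
  "verifies t x \<longleftrightarrow> t (antecedent x) \<and> t (consequent x)"

definition falsifies :: "('v form \<Rightarrow> bool) \<Rightarrow> 'v sentence \<Rightarrow> bool" where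
  "falsifies t x \<longleftrightarrow> t (antecedent x) \<and> \<not> t (consequent x)"

definition tolerated :: "'v sentence \<Rightarrow> 'v sentence set \<Rightarrow> bool" where
  "tolerated x Y \<longleftrightarrow> (\<exists>t. truth_assignment t \<and> verifies t x \<and> (\<forall>y\<in>Y. \<not> falsifies t y))"


definition prob_assignment :: "('v form \<Rightarrow> bool) pmf \<Rightarrow> bool" where
  "prob_assignment P \<longleftrightarrow> set_pmf P \<subseteq> {t. truth_assignment t}"

definition form_prob :: "(('v::finite) form \<Rightarrow> bool) pmf \<Rightarrow> 'v form \<Rightarrow> real" where
  "form_prob P \<phi> = (\<Sum>t | truth_assignment t. pmf P t * of_bool (t \<phi>))"

definition sentence_prob :: "(('v::finite) form \<Rightarrow> bool) pmf \<Rightarrow> 'v sentence \<Rightarrow> real" where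
  "sentence_prob P x =
     form_prob P (Conj (antecedent x) (consequent x)) / form_prob P (antecedent x)"

definition proper :: "(('v::finite) form \<Rightarrow> bool) pmf \<Rightarrow> 'v sentence set \<Rightarrow> bool" where
  "proper P X \<longleftrightarrow> (\<forall>x\<in>X. form_prob P (antecedent x) \<noteq> 0)"

definition p_consistent :: "('v::finite) sentence set \<Rightarrow> 'v sentence set \<Rightarrow> bool" where
  "p_consistent D S \<longleftrightarrow>
     (\<forall>\<epsilon>>0. \<exists>P. prob_assignment P \<and> proper P (D \<union> S) \<and>
        (\<forall>d\<in>D. sentence_prob P d \<ge> 1 - \<epsilon>) \<and> (\<forall>s\<in>S. sentence_prob P s = 1))"


text \<open>The procedure is a nondeterministic transition system: \<open>Phase1 D'\<close> carries the
  current value of the program variable \<open>D'\<close>, and the nondeterminism lies in the choice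
  of the tolerated sentence that is removed from it.\<close>

datatype verdict = CONSISTENT | INCONSISTENT

datatype 'v config = Phase1 "'v sentence set" | Phase2 | Report verdict

inductive step :: "'v sentence set \<Rightarrow> 'v config \<Rightarrow> 'v config \<Rightarrow> bool" for S where
  remove: "d \<in> D' \<Longrightarrow> tolerated d (S \<union> D') \<Longrightarrow> step S (Phase1 D') (Phase1 (D' - {d}))"
| stuck: "D' \<noteq> {} \<Longrightarrow> \<forall>d\<in>D'. \<not> tolerated d (S \<union> D') \<Longrightarrow>
    step S (Phase1 D') (Report INCONSISTENT)"
| emptied: "step S (Phase1 {}) Phase2"
| strict_fail: "s \<in> S \<Longrightarrow> \<not> tolerated s S \<Longrightarrow> step S Phase2 (Report INCONSISTENT)"
| strict_pass: "\<forall>s\<in>S. tolerated s S \<Longrightarrow> step S Phase2 (Report CONSISTENT)"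

text \<open>Whatever choices are made, the procedure started on \<open>D\<close> and \<open>S\<close> terminates and
  the configuration in which it halts is the report \<open>r\<close>.\<close>

definition always_reports :: "'v sentence set \<Rightarrow> 'v sentence set \<Rightarrow> verdict \<Rightarrow> bool" where
  "always_reports D S r \<longleftrightarrow>
     (\<nexists>c :: nat \<Rightarrow> 'v config. c 0 = Phase1 D \<and> (\<forall>n. step S (c n) (c (Suc n)))) \<and>
     (\<forall>c. (step S)\<^sup>*\<^sup>* (Phase1 D) c \<and> (\<nexists>c'. step S c c') \<longrightarrow> c = Report r)"

end

theory Submission
  imports Defs
begin

text \<open>Each step of the procedure preserves p-consistency in both directions, so the verdict does
  not depend on the choices. If \<open>d\<close> is tolerated by \<open>S \<union> D'\<close> through \<open>t\<close>, then putting
  mass \<open>1 - \<epsilon>\<close> on \<open>t\<close> and mass \<open>\<epsilon>\<close> on an assignment that is good for \<open>D' - {d}\<close>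
  gives an assignment that is good for \<open>D'\<close>. If no element of \<open>D' \<noteq> {}\<close> is tolerated, every
  truth assignment satisfying an antecedent of \<open>D'\<close> and falsifying nothing in \<open>S\<close> falsifies some
  element of \<open>D'\<close>; hence the falsification probabilities add up to at least the probability of
  each antecedent, which is impossible once they are small relative to the antecedents.\<close>

section \<open>Probabilities of formulas and of conditional sentences\<close>

lemma truth_assignment_simps:
  assumes "truth_assignment t"
  shows "t (Neg \<phi>) \<longleftrightarrow> \<not> t \<phi>"
    "t (Conj \<phi> \<psi>) \<longleftrightarrow> t \<phi> \<and> t \<psi>"
  using assms by (auto simp: truth_assignment_def)

lemma truth_assignment_exists: "\<exists>t :: 'v form \<Rightarrow> bool. truth_assignment t"
proof -
  define t :: "'v form \<Rightarrow> bool" where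
    "t = rec_form (\<lambda>_. True) False (\<lambda>_ a. \<not> a) (\<lambda>_ _ a b. a \<and> b)
      (\<lambda>_ _ a b. a \<or> b) (\<lambda>_ _ a b. a \<longrightarrow> b)"
  have "truth_assignment t"
    by (simp add: truth_assignment_def t_def)
  then show ?thesis by blast
qed

lemma form_prob_nonneg: "0 \<le> form_prob P \<phi>"
  by (simp add: form_prob_def sum_nonneg)

lemma form_prob_le_1: "form_prob P (\<phi> :: ('v::finite) form) \<le> 1"
proof -
  have "form_prob P \<phi> \<le> (\<Sum>t | truth_assignment t. pmf P t)"
    unfolding form_prob_def by (rule sum_mono) simp
  also have "\<dots> = measure_pmf.prob P {t. truth_assignment t}"
    by (simp add: measure_measure_pmf_finite finite_truth_assignments)
  finally show ?thesis
    using measure_pmf.prob_le_1 order_trans by blast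
qed

lemma form_prob_split:
  "form_prob P \<phi> = form_prob P (Conj \<phi> \<psi>) + form_prob P (Conj \<phi> (Neg \<psi>))"
  unfolding form_prob_def sum.distrib[symmetric]
  by (rule sum.cong) (auto simp: truth_assignment_simps)

lemma form_prob_eq_0_iff:
  "form_prob P \<phi> = 0 \<longleftrightarrow> (\<forall>t\<in>set_pmf P. truth_assignment t \<longrightarrow> \<not> t \<phi>)"
  unfolding form_prob_def
  by (subst sum_nonneg_eq_0_iff)
    (auto simp: finite_truth_assignments set_pmf_iff)

text \<open>A union bound. The covering is asked only on the support of \<open>P\<close>: elsewhere
  the terms on the left vanish, and this is where strict sentences may be falsified.\<close>

lemma form_prob_le_sum:
  fixes P :: "(('v::finite) form \<Rightarrow> bool) pmf"
  assumes "finite I"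
    and cover: "\<And>t. t \<in> set_pmf P \<Longrightarrow> truth_assignment t \<Longrightarrow> t \<phi> \<Longrightarrow> \<exists>i\<in>I. t (\<psi> i)"
  shows "form_prob P \<phi> \<le> (\<Sum>i\<in>I. form_prob P (\<psi> i))"
proof -
  have "form_prob P \<phi> \<le> (\<Sum>t | truth_assignment t. \<Sum>i\<in>I. pmf P t * of_bool (t (\<psi> i)))"
    unfolding form_prob_def
  proof (rule sum_mono)
    fix t :: "'v form \<Rightarrow> bool" assume t: "t \<in> {t. truth_assignment t}"
    show "pmf P t * of_bool (t \<phi>) \<le> (\<Sum>i\<in>I. pmf P t * of_bool (t (\<psi> i)))"
    proof (cases "t \<in> set_pmf P \<and> t \<phi>")
      case True
      with t cover obtain i where i: "i \<in> I" "t (\<psi> i)" by auto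
      have "pmf P t * of_bool (t (\<psi> i)) \<le> (\<Sum>i\<in>I. pmf P t * of_bool (t (\<psi> i)))"
        using assms(1) i(1) by (intro member_le_sum) auto
      with i True show ?thesis by simp
    next
      case False
      then show ?thesis by (auto simp: set_pmf_iff sum_nonneg)
    qed
  qed
  also have "\<dots> = (\<Sum>i\<in>I. form_prob P (\<psi> i))"
    unfolding form_prob_def by (rule sum.swap)
  finally show ?thesis .
qed

lemma sentence_prob_eq:
  assumes "form_prob P (antecedent x) \<noteq> 0"
  shows "sentence_prob P x =
    1 - form_prob P (Conj (antecedent x) (Neg (consequent x))) / form_prob P (antecedent x)"
proof -
  have "form_prob P (Conj (antecedent x) (consequent x)) =
    form_prob P (antecedent x) - form_prob P (Conj (antecedent x) (Neg (consequent x)))"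
    using form_prob_split[of P "antecedent x" "consequent x"] by simp
  then show ?thesis
    using assms by (simp add: sentence_prob_def diff_divide_distrib)
qed

text \<open>The falsifying formula must get mass 0, so a strict constraint concerns the support
  alone, which is easy to track when distributions are mixed.\<close>

lemma sentence_prob_eq_1_iff:
  assumes "form_prob P (antecedent x) \<noteq> 0"
  shows "sentence_prob P x = 1 \<longleftrightarrow>
    (\<forall>t\<in>set_pmf P. truth_assignment t \<longrightarrow> \<not> falsifies t x)"
  using assms
  by (auto simp: sentence_prob_eq form_prob_eq_0_iff truth_assignment_simps falsifies_def)

text \<open>Clearing the denominator makes the bound linear in formula probabilities, so that it can
  be summed over \<open>D\<close> and carried through a mixture.\<close>

lemma sentence_prob_ge_iff:
  assumes "form_prob P (antecedent x) \<noteq> 0"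
  shows "sentence_prob P x \<ge> 1 - \<epsilon> \<longleftrightarrow>
    form_prob P (Conj (antecedent x) (Neg (consequent x))) \<le> \<epsilon> * form_prob P (antecedent x)"
proof -
  have "form_prob P (antecedent x) > 0"
    using assms form_prob_nonneg[of P "antecedent x"] by linarith
  then show ?thesis
    using assms by (simp add: sentence_prob_eq pos_divide_le_eq)
qed

section \<open>Consequences of p-consistency and the case without defeasible sentences\<close>

lemma p_consistent_mono:
  assumes "p_consistent D S" "D' \<subseteq> D"
  shows "p_consistent D' S"
  unfolding p_consistent_def
proof (intro allI impI)
  fix \<epsilon> :: real assume "\<epsilon> > 0"
  with assms(1) obtain P where "prob_assignment P" "proper P (D \<union> S)"
    "\<forall>d\<in>D. sentence_prob P d \<ge> 1 - \<epsilon>" "\<forall>s\<in>S. sentence_prob P s = 1"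
    unfolding p_consistent_def by blast
  with assms(2) show "\<exists>P. prob_assignment P \<and> proper P (D' \<union> S) \<and>
      (\<forall>d\<in>D'. sentence_prob P d \<ge> 1 - \<epsilon>) \<and> (\<forall>s\<in>S. sentence_prob P s = 1)"
    by (intro exI[of _ P]) (auto simp: proper_def)
qed

lemma p_consistent_tolerated:
  assumes "p_consistent D S" "finite D" "D \<noteq> {}"
  shows "\<exists>d\<in>D. tolerated d (S \<union> D)"
proof (rule ccontr)
  assume not_tol: "\<not> ?thesis"
  \<comment> \<open>Summing the bound \<open>A_le\<close> over \<open>D\<close> costs a factor
    \<open>card D\<close>; this \<epsilon> cancels it and leaves a factor 1/2, so the positive sum
    of the \<open>A d\<close> is at most half of itself.\<close>
  define \<epsilon> :: real where "\<epsilon> = 1 / (2 * card D)"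
  have card: "real (card D) > 0"
    using assms(2,3) by (simp add: card_gt_0_iff)
  then have "\<epsilon> > 0" by (simp add: \<epsilon>_def)
  with assms(1) obtain P where P: "prob_assignment P" "proper P (D \<union> S)"
    "\<forall>d\<in>D. sentence_prob P d \<ge> 1 - \<epsilon>" "\<forall>s\<in>S. sentence_prob P s = 1"
    unfolding p_consistent_def by blast
  define A where "A d = form_prob P (antecedent d)" for d
  define F where "F d = form_prob P (Conj (antecedent d) (Neg (consequent d)))" for d
  have A_pos: "A d > 0" if "d \<in> D" for d
    using P(2) that form_prob_nonneg[of P "antecedent d"]
    by (auto simp: proper_def A_def order_less_le)
  have F_le: "F d \<le> \<epsilon> * A d" if "d \<in> D" for d
    using P(2,3) that by (auto simp: A_def F_def proper_def simp flip: sentence_prob_ge_iff)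
  have A_le: "A d \<le> (\<Sum>d'\<in>D. F d')" if "d \<in> D" for d
    unfolding A_def F_def
  proof (rule form_prob_le_sum[OF assms(2)])
    fix t assume t: "t \<in> set_pmf P" "truth_assignment t" "t (antecedent d)"
    have "\<not> falsifies t s" if "s \<in> S" for s
      using P(2,4) t that sentence_prob_eq_1_iff[of P s] by (auto simp: proper_def)
    \<comment> \<open>Either \<open>t\<close> falsifies \<open>d\<close>, or it verifies
      \<open>d\<close> and, as \<open>d\<close> is not tolerated, falsifies some other sentence;
      strict ones are excluded by the support of \<open>P\<close>.\<close>
    moreover have "\<exists>y\<in>S \<union> D. falsifies t y"
    proof (cases "falsifies t d")
      case False
      with t have "verifies t d" by (auto simp: verifies_def falsifies_def)
      with not_tol \<open>d \<in> D\<close> t(2) show ?thesis by (auto simp: tolerated_def)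
    qed (use \<open>d \<in> D\<close> in blast)
    ultimately have "\<exists>d'\<in>D. falsifies t d'" by blast
    then show "\<exists>d'\<in>D. t (Conj (antecedent d') (Neg (consequent d')))"
      using t by (auto simp: falsifies_def truth_assignment_simps)
  qed
  have "(\<Sum>d\<in>D. A d) \<le> card D * (\<Sum>d\<in>D. F d)"
    using sum_mono[of D A "\<lambda>_. \<Sum>d'\<in>D. F d'"] A_le by simp
  also have "\<dots> \<le> card D * (\<Sum>d\<in>D. \<epsilon> * A d)"
    by (intro mult_left_mono sum_mono F_le) auto
  also have "\<dots> = (\<Sum>d\<in>D. A d) / 2"
    using card by (simp add: \<epsilon>_def flip: sum_divide_distrib)
  finally have "(\<Sum>d\<in>D. A d) \<le> 0" by simp
  moreover have "(\<Sum>d\<in>D. A d) > 0"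
    using assms(2,3) A_pos by (intro sum_pos) auto
  ultimately show False by simp
qed

text \<open>Any assignment in the support that satisfies the antecedent of \<open>s\<close> is a
  witness, since nothing in the support falsifies a sentence of \<open>S\<close>. A single
  distribution suffices, so \<epsilon> = 1 is taken.\<close>

lemma p_consistent_strict_tolerated:
  assumes "p_consistent D S" "s \<in> S"
  shows "tolerated s S"
proof -
  from assms(1) obtain P where P: "prob_assignment P" "proper P (D \<union> S)"
    "\<forall>s\<in>S. sentence_prob P s = 1"
    unfolding p_consistent_def using zero_less_one by blast
  from P(2) assms(2) obtain t where t: "t \<in> set_pmf P" "truth_assignment t" "t (antecedent s)"
    by (auto simp: proper_def form_prob_eq_0_iff)
  have no_fals: "\<not> falsifies t s'" if "s' \<in> S" for s'
    using P(2,3) t that sentence_prob_eq_1_iff[of P s'] by (auto simp: proper_def)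
  with t assms(2) have "verifies t s"
    by (auto simp: verifies_def falsifies_def)
  with t no_fals show ?thesis
    by (auto simp: tolerated_def)
qed

text \<open>The uniform distribution on all assignments that falsify nothing in \<open>S\<close>
  works: its support contains every witness of tolerance, which makes it proper.\<close>

lemma p_consistent_empty:
  fixes S :: "('v::finite) sentence set"
  assumes "\<forall>s\<in>S. tolerated s S"
  shows "p_consistent {} S"
proof -
  define T where "T = {t. truth_assignment t \<and> (\<forall>s\<in>S. \<not> falsifies t s)}"
  have fin: "finite T"
    unfolding T_def by (rule finite_subset[OF _ finite_truth_assignments]) auto
  \<comment> \<open>An empty \<open>S\<close> provides no tolerance witness, so an arbitrary truth
    assignment is taken there.\<close>
  have "T \<noteq> {}"
  proof (cases "S = {}")
    case True
    then show ?thesis using truth_assignment_exists by (auto simp: T_def)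
  next
    case False
    then show ?thesis using assms by (fastforce simp: T_def tolerated_def)
  qed
  with fin have set: "set_pmf (pmf_of_set T) = T" by (rule set_pmf_of_set[rotated])
  have "prob_assignment (pmf_of_set T)"
    using set by (auto simp: prob_assignment_def T_def)
  moreover have "proper (pmf_of_set T) S"
    unfolding proper_def form_prob_eq_0_iff set
    using assms by (fastforce simp: T_def tolerated_def verifies_def)
  moreover from this have "sentence_prob (pmf_of_set T) s = 1" if "s \<in> S" for s
    using that set by (auto simp: proper_def sentence_prob_eq_1_iff T_def)
  ultimately show ?thesis
    by (auto simp: p_consistent_def)
qed

section \<open>Mixing a distribution with a point mass\<close>

definition mix_pmf :: "real \<Rightarrow> 'a pmf \<Rightarrow> 'a \<Rightarrow> 'a pmf" where
  "mix_pmf \<delta> P x = bind_pmf (bernoulli_pmf \<delta>) (\<lambda>b. if b then P else return_pmf x)"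

lemma pmf_mix:
  assumes "0 \<le> \<delta>" "\<delta> \<le> 1"
  shows "pmf (mix_pmf \<delta> P x) y = \<delta> * pmf P y + (1 - \<delta>) * of_bool (x = y)"
  using assms by (simp add: mix_pmf_def pmf_bind pmf_return)

text \<open>\<open>form_prob\<close> sums over truth assignments only, so the point mass is counted
  because \<open>t\<close> is one.\<close>

lemma form_prob_mix:
  assumes "0 \<le> \<delta>" "\<delta> \<le> 1" "truth_assignment t"
  shows "form_prob (mix_pmf \<delta> P t) \<phi> = \<delta> * form_prob P \<phi> + (1 - \<delta>) * of_bool (t \<phi>)"
proof -
  have "(\<Sum>u | truth_assignment u. of_bool (t = u) * of_bool (u \<phi>)) = (of_bool (t \<phi>) :: real)"
    by (subst sum.remove[where x = t]) (auto simp: assms finite_truth_assignments intro!: sum.neutral)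
  then show ?thesis
    by (simp add: form_prob_def pmf_mix assms(1,2) distrib_right sum.distrib mult.assoc
        flip: sum_distrib_left)
qed

lemma p_consistent_insert_tolerated:
  assumes "p_consistent (D - {d}) S" "d \<in> D" "tolerated d (S \<union> D)"
  shows "p_consistent D S"
  unfolding p_consistent_def
proof (intro allI impI)
  fix \<epsilon> :: real assume "\<epsilon> > 0"
  \<comment> \<open>\<delta> is the weight of the old distribution \<open>P\<close>: at most
    \<epsilon> to handle \<open>d\<close>, and below 1 so that \<open>t\<close> keeps positive
    mass.\<close>
  define \<delta> where "\<delta> = min \<epsilon> (1/2)"
  have \<delta>: "0 < \<delta>" "\<delta> < 1" "\<delta> \<le> \<epsilon>"
    using \<open>\<epsilon> > 0\<close> by (auto simp: \<delta>_def)
  from assms(1) \<open>\<epsilon> > 0\<close> obtain P where P: "prob_assignment P" "proper P (D - {d} \<union> S)"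
    "\<forall>d\<in>D - {d}. sentence_prob P d \<ge> 1 - \<epsilon>" "\<forall>s\<in>S. sentence_prob P s = 1"
    unfolding p_consistent_def by blast
  from assms(3) obtain t where t: "truth_assignment t" "verifies t d"
    "\<forall>x\<in>S \<union> D. \<not> falsifies t x"
    by (auto simp: tolerated_def)
  define Q where "Q = mix_pmf \<delta> P t"
  have Q: "form_prob Q \<phi> = \<delta> * form_prob P \<phi> + (1 - \<delta>) * of_bool (t \<phi>)" for \<phi>
    unfolding Q_def using \<delta> t by (intro form_prob_mix) auto
  have set_Q: "set_pmf Q \<subseteq> insert t (set_pmf P)"
    by (auto simp: Q_def mix_pmf_def split: if_splits)
  then have "prob_assignment Q"
    using P(1) t(1) by (auto simp: prob_assignment_def)
  moreover have proper: "proper Q (D \<union> S)"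
    unfolding proper_def
  proof
    fix x assume x: "x \<in> D \<union> S"
    \<comment> \<open>\<open>t\<close> takes care of \<open>d\<close>, and \<open>P\<close> of all
      other sentences.\<close>
    have "t (antecedent x) \<or> form_prob P (antecedent x) > 0"
      using x P(2) t(2) form_prob_nonneg[of P "antecedent x"]
      by (cases "x = d") (auto simp: proper_def verifies_def order_less_le)
    then have "form_prob Q (antecedent x) > 0"
      unfolding Q using \<delta> form_prob_nonneg[of P "antecedent x"]
      by (cases "t (antecedent x)") (auto intro: add_nonneg_pos)
    then show "form_prob Q (antecedent x) \<noteq> 0" by simp
  qed
  moreover have "sentence_prob Q s = 1" if s: "s \<in> S" for s
  proof -
    have "\<not> falsifies u s" if "u \<in> set_pmf P" "truth_assignment u" for u
      using P(2,4) s that sentence_prob_eq_1_iff[of P s] by (auto simp: proper_def)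
    then show ?thesis
      using s proper t(3) set_Q by (subst sentence_prob_eq_1_iff) (auto simp: proper_def)
  qed
  moreover have "sentence_prob Q x \<ge> 1 - \<epsilon>" if x: "x \<in> D" for x
  proof -
    let ?a = "antecedent x" and ?f = "Conj (antecedent x) (Neg (consequent x))"
    \<comment> \<open>\<open>t\<close> falsifies nothing in \<open>D\<close>, so all falsifying mass
      comes from \<open>P\<close>.\<close>
    have "form_prob Q ?f = \<delta> * form_prob P ?f"
      using t(1,3) x by (auto simp: Q falsifies_def truth_assignment_simps)
    also have "\<dots> \<le> \<epsilon> * form_prob Q ?a"
    proof (cases "x = d")
      case True
      \<comment> \<open>\<open>P\<close> is not controlled on \<open>d\<close>, so only the trivial
        bound by the antecedent is available. As \<open>t\<close> satisfies this antecedent, passing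
        from \<open>P\<close> to \<open>Q\<close> can only raise its probability, and \<delta> \<le>
        \<epsilon> gives the required factor.\<close>
      have "\<delta> * form_prob P ?f \<le> \<delta> * form_prob P ?a"
        using \<delta> form_prob_split[of P ?a "consequent x"]
          form_prob_nonneg[of P "Conj ?a (consequent x)"] by simp
      also have "\<dots> \<le> \<delta> * form_prob Q ?a"
        using True t(2) \<delta> form_prob_le_1[of P ?a] mult_left_le[of "form_prob P ?a" "1 - \<delta>"]
        by (intro mult_left_mono) (auto simp: Q verifies_def algebra_simps)
      also have "\<dots> \<le> \<epsilon> * form_prob Q ?a"
        using \<delta> by (intro mult_right_mono form_prob_nonneg)
      finally show ?thesis .
    next
      case False
      then have "form_prob P ?f \<le> \<epsilon> * form_prob P ?a"
        using x P(2,3) by (auto simp: proper_def simp flip: sentence_prob_ge_iff)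
      then have "\<delta> * form_prob P ?f \<le> \<epsilon> * (\<delta> * form_prob P ?a)"
        using \<delta> by simp
      also have "\<dots> \<le> \<epsilon> * form_prob Q ?a"
        using \<delta> \<open>\<epsilon> > 0\<close> by (simp add: Q)
      finally show ?thesis .
    qed
    finally show ?thesis
      using x proper by (subst sentence_prob_ge_iff) (auto simp: proper_def)
  qed
  ultimately show "\<exists>P. prob_assignment P \<and> proper P (D \<union> S) \<and>
      (\<forall>d\<in>D. sentence_prob P d \<ge> 1 - \<epsilon>) \<and> (\<forall>s\<in>S. sentence_prob P s = 1)"
    by blast
qed

section \<open>Invariant and termination of the procedure\<close>

fun config_ok :: "('v::finite) sentence set \<Rightarrow> bool \<Rightarrow> 'v config \<Rightarrow> bool" where
  "config_ok S b (Phase1 D) \<longleftrightarrow> finite D \<and> (p_consistent D S \<longleftrightarrow> b)"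
| "config_ok S b Phase2 \<longleftrightarrow> (p_consistent {} S \<longleftrightarrow> b)"
| "config_ok S b (Report r) \<longleftrightarrow> r = (if b then CONSISTENT else INCONSISTENT)"

text \<open>Here \<open>b\<close> stands for the p-consistency of the initial sets. Removal keeps
  p-consistency by passing to a subset and keeps its failure by the mixture argument; the tolerance
  lemmas justify each report.\<close>

lemma step_config_ok:
  assumes "step S c c'" "config_ok S b c"
  shows "config_ok S b c'"
  using assms
proof cases
  case (remove d D)
  then show ?thesis
    using assms(2) p_consistent_insert_tolerated[of D d S] p_consistent_mono[of D S "D - {d}"]
    by auto
next
  case (stuck D)
  then show ?thesis using assms(2) p_consistent_tolerated[of D S] by auto
next
  case (strict_fail s)
  then show ?thesis using assms(2) p_consistent_strict_tolerated[of "{}" S s] by auto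
next
  case strict_pass
  then show ?thesis using assms(2) p_consistent_empty[of S] by auto
qed auto

lemma halted_is_Report:
  assumes "\<nexists>c'. step S c c'"
  shows "\<exists>r. c = Report r"
proof (cases c)
  case (Phase1 D)
  then show ?thesis using assms by (metis step.remove step.stuck step.emptied)
next
  case Phase2
  then show ?thesis using assms by (metis step.strict_fail step.strict_pass)
qed simp

text \<open>The offset 2 keeps \<open>Phase1 {}\<close> above \<open>Phase2\<close>, which in turn
  lies above every report.\<close>

fun config_size :: "'v config \<Rightarrow> nat" where
  "config_size (Phase1 D) = card D + 2"
| "config_size Phase2 = 1"
| "config_size (Report r) = 0"

text \<open>The invariant supplies the finiteness of the current set, so that removing an element
  lowers \<open>card\<close>.\<close>

lemma step_config_size:
  assumes "step S c c'" "config_ok S b c"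
  shows "config_size c' < config_size c"
  using assms by cases (auto intro: card_Diff1_less simp del: card_Diff_insert)

lemma no_infinite_run:
  assumes "config_ok S b (c 0)" "\<And>n. step S (c n) (c (Suc n))"
  shows False
proof -
  have "config_ok S b (c n)" for n
    by (induction n) (use assms step_config_ok in blast)+
  then have "config_size (c (Suc n)) < config_size (c n)" for n
    using assms(2) step_config_size by blast
  then show False
    using wf_less_than[unfolded wf_iff_no_infinite_down_chain]
    by (auto dest!: spec[of _ "\<lambda>n. config_size (c n)"])
qed

text \<open>A reachable halted configuration is a report, and the invariant there determines which
  one.\<close>

lemma always_reports_verdict:
  assumes "finite D"
  shows "always_reports D S (if p_consistent D S then CONSISTENT else INCONSISTENT)"
proof -
  let ?ok = "config_ok S (p_consistent D S)"
  have start: "?ok (Phase1 D)" using assms by simp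
  have "?ok c" if "(step S)\<^sup>*\<^sup>* (Phase1 D) c" for c
    using that by induction (use start step_config_ok in blast)+
  then show ?thesis
    unfolding always_reports_def
    using start no_infinite_run[of S "p_consistent D S"] halted_is_Report[of S]
    by (metis config_ok.simps(3))
qed

theorem mainTheorem5:
  fixes D S :: "('v::finite) sentence set"
  assumes "finite D" and "finite S"
    and "\<forall>d\<in>D. is_defeasible d"
    and "\<forall>s\<in>S. is_strict s"
  shows "(p_consistent D S \<longrightarrow> always_reports D S CONSISTENT) \<and>
         (\<not> p_consistent D S \<longrightarrow> always_reports D S INCONSISTENT)"
  using always_reports_verdict[OF assms(1), of S] by (auto split: if_splits)

end
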